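(* Let $n\ge 1$, let $\alpha_1,\dots,\alpha_n\in(0,1]$, and let $X_1,\dots,X_n$ be independent real-valued random variables such that $\mathcal{Q}_2(X_i)\le \alpha_i$ for each $i=1,\dots,n$. Let $T_1(\alpha_1),\dots,T_n(\alpha_n)$ be independent random variables, where $T_i(\alpha_i)$ has the distribution of $T(\alpha_i)$. Then for every integer $\ell\ge 1$, $$\mathcal{Q}_{2\ell}\left(X_1+\cdots+X_n\right)\le \mathcal{Q}_{2\ell}\left(T_1(\alpha_1)+\cdots+T_n(\alpha_n)\right).$$
   Context: For a real-valued random variable $X$ and $h>0$, the concentration function is $\mathcal{Q}_h(X)=\sup_{x\in\mathbb{R}}\mathbb{P}(X\in(x,x+h])$. For an integer $k\ge1$, $\nu^k$ denotes the uniform distribution on the $k$-term arithmetic progression $\{-k+1,-k+3,\dots,k-1\}$. For $\alpha\in(0,1]$, choose an integer $k\ge 1$ with $\alpha\in[\frac1{k+1},\frac1k]$; then $T(\alpha)$ denotes a random variable with distribution $(1-\tau)\nu^{k+1}+\tau\nu^k$, where $\tau=k(k+1)\alpha-k$ (this is consistent when $\alpha$ is an endpoint of two such intervals; in particular $T(1/k)$ has distribution $\nu^k$). *)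

theory Defs
  imports "HOL-Probability.Probability"
begin

definition concentration :: "'a measure \<Rightarrow> real \<Rightarrow> ('a \<Rightarrow> real) \<Rightarrow> real" where
  "concentration M h X = (SUP x::real. measure M {\<omega> \<in> space M. X \<omega> \<in> {x<..x + h}})"

definition nu :: "nat \<Rightarrow> real pmf" where
  "nu k = pmf_of_set ((\<lambda>j. 2 * real j - real k + 1) ` {..<k})"

definition nu_mixture :: "nat \<Rightarrow> real \<Rightarrow> real pmf" where
  "nu_mixture k \<alpha> =
     bind_pmf (bernoulli_pmf (real k * (real k + 1) * \<alpha> - real k))
       (\<lambda>b. if b then nu k else nu (k + 1))"

definition T_index :: "real \<Rightarrow> nat \<Rightarrow> bool" where
  "T_index \<alpha> k \<longleftrightarrow> 1 \<le> k \<and> \<alpha> \<in> {1 / (real k + 1)..1 / real k}"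

(* The interval endpoints admit two indices k; by T_pmf_eq below the law does not
   depend on which one is chosen, and T_index_ex gives an index for each
   \<alpha> in (0,1]. *)
definition T_pmf :: "real \<Rightarrow> real pmf" where
  "T_pmf \<alpha> = nu_mixture (SOME k. T_index \<alpha> k) \<alpha>"

(* The source sigma-algebra of measure_pmf is discrete; the identity map
   restricts the law to the Borel sets. *)
definition T_law :: "real \<Rightarrow> real measure" where
  "T_law \<alpha> = distr (measure_pmf (T_pmf \<alpha>)) borel (\<lambda>x. x)"

lemma bernoulli_pmf_0: "bernoulli_pmf 0 = return_pmf False"
proof (rule pmf_eqI)
  fix b show "pmf (bernoulli_pmf 0) b = pmf (return_pmf False) b"
    by (cases b) auto
qed

lemma bernoulli_pmf_1: "bernoulli_pmf 1 = return_pmf True"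
proof (rule pmf_eqI)
  fix b show "pmf (bernoulli_pmf 1) b = pmf (return_pmf True) b"
    by (cases b) auto
qed

lemma T_index_ex:
  assumes "\<alpha> \<in> {0<..1}"
  shows "\<exists>k. T_index \<alpha> k"
proof -
  define k where "k = nat \<lfloor>1 / \<alpha>\<rfloor>"
  have a: "0 < \<alpha>" "1 \<le> 1 / \<alpha>" using assms by auto
  have fl: "1 \<le> \<lfloor>1 / \<alpha>\<rfloor>" using a by linarith
  have k: "1 \<le> k" unfolding k_def using fl by linarith
  have rk: "real k = of_int \<lfloor>1 / \<alpha>\<rfloor>" unfolding k_def using fl by (intro of_nat_nat) linarith
  have "real k \<le> 1 / \<alpha>" "1 / \<alpha> \<le> real k + 1" unfolding rk by linarith+
  then have "T_index \<alpha> k"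
    using a k by (simp add: T_index_def field_simps)
  then show ?thesis by blast
qed

lemma nu_mixture_unique_less:
  assumes "T_index \<alpha> k" "T_index \<alpha> m" "k < m"
  shows "nu_mixture k \<alpha> = nu_mixture m \<alpha>"
proof -
  have "1 / (real k + 1) \<le> 1 / real m"
    using assms by (auto simp: T_index_def)
  then have "real m \<le> real k + 1"
    using assms by (simp add: T_index_def field_simps)
  then have m: "m = k + 1" using assms by linarith
  then have \<alpha>: "\<alpha> = 1 / (real k + 1)"
    using assms by (auto simp: T_index_def add.commute)
  have z: "real k * (real k + 1) * \<alpha> - real k = 0"
    unfolding \<alpha> by simp
  have "real m * \<alpha> = 1" unfolding m \<alpha> by simp
  then have "(real m + 1) * (real m * \<alpha>) = real m + 1" by simp
  then have w: "real m * (real m + 1) * \<alpha> - real m = 1"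
    by (simp only: mult.commute mult.left_commute)
  show ?thesis
    unfolding nu_mixture_def z w
    by (simp add: bernoulli_pmf_0 bernoulli_pmf_1 bind_return_pmf m)
qed

lemma T_pmf_eq:
  assumes "T_index \<alpha> k"
  shows "T_pmf \<alpha> = nu_mixture k \<alpha>"
proof -
  have "T_index \<alpha> (SOME k. T_index \<alpha> k)" using assms by (rule someI)
  then show ?thesis
    unfolding T_pmf_def using assms
    by (metis nu_mixture_unique_less linorder_neqE_nat)
qed

end

theory Submission
  imports Defs
begin

text \<open>
  The quantile transform exhibits a law with \<open>\<Q>\<^sub>2 \<le> \<alpha>\<close> as a mixture of uniform laws on lists of
  real numbers with gaps at least 2: for the quantile function \<open>I\<close> and \<open>u \<in> (0, \<alpha>)\<close> the points
  \<open>I u, I (u + \<alpha>), I (u + 2\<alpha>), \<dots>\<close> have such gaps, and there are \<open>k + 1\<close> or \<open>k\<close> of them, with the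
  same weights as those of \<open>\<nu>\<^sup>k\<^sup>+\<^sup>1\<close> and \<open>\<nu>\<^sup>k\<close> in \<open>T(\<alpha>)\<close>. This reduces the theorem to the case of
  uniform laws on such lists, which is a counting problem of Littlewood--Offord type. There the
  symmetric chain decomposition of a product of chains splits the multiset of all sums into chains
  with gaps at least 2, each meeting \<open>(x, x + 2l]\<close> in at most \<open>l\<close> points. For centred arithmetic
  progressions the chains are themselves centred progressions, and \<open>(-l, l]\<close> attains the bound
  on all of them simultaneously.
\<close>

section \<open>Separated lists, grids of sums, and their decomposition into chains\<close>

definition sep :: "real list \<Rightarrow> bool" where
  "sep = sorted_wrt (\<lambda>a b. a + 2 \<le> b)"

text \<open>Lists rather than sets, so that coinciding sums keep their multiplicity. Only the
  multiset of the entries matters later.\<close>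

definition pairsums :: "real list \<Rightarrow> real list \<Rightarrow> real list" where
  "pairsums xs ys = concat (map (\<lambda>x. map (\<lambda>y. x + y) ys) xs)"

definition multisums :: "real list list \<Rightarrow> real list" where
  "multisums yss = foldr pairsums yss [0]"

text \<open>For \<open>k > 0\<close> this is the support of \<open>nu k\<close>, listed in
  increasing order.\<close>

definition AP :: "nat \<Rightarrow> real list" where
  "AP k = map (\<lambda>j. 2 * real j - real k + 1) [0..<k]"

lemma length_AP [simp]: "length (AP k) = k"
  by (simp add: AP_def)

lemma AP_0 [simp]: "AP 0 = []"
  by (simp add: AP_def)

lemma nth_AP: "i < k \<Longrightarrow> AP k ! i = 2 * real i - real k + 1"
  by (simp add: AP_def)

lemma AP_Suc_Cons: "AP (Suc k) = - real k # map ((+) 1) (AP k)"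
  by (rule nth_equalityI) (auto simp: nth_AP nth_Cons split: nat.splits)

lemma AP_Suc_snoc: "AP (Suc k) = map ((+) (- 1)) (AP k) @ [real k]"
  by (rule nth_equalityI) (auto simp: nth_AP nth_append less_Suc_eq)

text \<open>The right-hand side has the shape of a hook (first row, then last column) in a grid of
  centred progressions; this identity shows that such a hook is again a centred progression.\<close>

lemma AP_add: "AP (m + k) = map ((+) (- real m)) (AP k) @ map ((+) (real k)) (AP m)"
  by (rule nth_equalityI) (auto simp: nth_AP nth_append of_nat_diff)

lemma pairsums_Nil [simp]: "pairsums [] ys = []" "pairsums xs [] = []"
  by (simp_all add: pairsums_def)

lemma pairsums_Cons: "pairsums (x # xs) ys = map ((+) x) ys @ pairsums xs ys"
  by (simp add: pairsums_def)

lemma mset_pairsums_append: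
  "mset (pairsums xs (ys @ zs)) = mset (pairsums xs ys) + mset (pairsums xs zs)"
  by (induction xs) (simp_all add: pairsums_Cons)

lemma mset_pairsums_cong:
  "mset ys = mset zs \<Longrightarrow> mset (pairsums xs ys) = mset (pairsums xs zs)"
  by (induction xs) (simp_all add: pairsums_Cons)

lemma pairsums_shift:
  "pairsums (map ((+) a) xs) (map ((+) (- a)) ys) = pairsums xs ys"
  by (induction xs) (simp_all add: pairsums_Cons o_def algebra_simps)

lemma pairsums_single: "pairsums xs [y] = map ((+) y) xs"
  by (simp add: pairsums_def concat_map_singleton add.commute)

text \<open>The last column together with the first row of the grid of sums is a maximal chain, and the
  remaining grid has one row and one column less.\<close>

lemma mset_pairsums_hook:
  "mset (pairsums (x # xs) (ys @ [y])) =
     mset (map ((+) x) ys @ map ((+) y) (x # xs)) + mset (pairsums xs ys)"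
  by (simp add: pairsums_Cons mset_pairsums_append pairsums_single)

text \<open>Along the first row only the second summand grows, along the last column only the first.
  The corner \<open>x + y\<close> occurs once, at the start of the second piece.\<close>

lemma sep_hook:
  assumes "sep (x # xs)" "sep (ys @ [y])"
  shows "sep (map ((+) x) ys @ map ((+) y) (x # xs))"
  using assms by (fastforce simp: sep_def sorted_wrt_append sorted_wrt_map)

text \<open>Hooks are peeled off one after another, and their lengths depend only on the lengths of
  the two lists. In the grid of centred progressions the hooks are centred progressions of the same
  lengths, so a single \<open>cs\<close> describes both multisets.\<close>

lemma pairsums_chains:
  assumes "sep xs" "sep ys"
  shows "\<exists>cs. mset (pairsums xs ys) = mset (concat cs) \<and> (\<forall>c\<in>set cs. sep c) \<and>
    mset (pairsums (AP (length xs)) (AP (length ys))) = mset (concat (map (\<lambda>c. AP (length c)) cs))"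
  using assms
proof (induction xs arbitrary: ys)
  case Nil
  then show ?case by (intro exI[of _ "[]"]) simp
next
  case (Cons x xs)
  show ?case
  proof (cases ys rule: rev_cases)
    case Nil
    then show ?thesis by (intro exI[of _ "[]"]) simp
  next
    case (snoc zs y)
    let ?h = "map ((+) x) zs @ map ((+) y) (x # xs)"
    have "sep xs" "sep zs"
      using Cons.prems snoc by (auto simp: sep_def sorted_wrt_append)
    then obtain cs where cs: "mset (pairsums xs zs) = mset (concat cs)" "\<forall>c\<in>set cs. sep c"
      "mset (pairsums (AP (length xs)) (AP (length zs))) = mset (concat (map (\<lambda>c. AP (length c)) cs))"
      using Cons.IH by blast
    have h: "AP (length ?h) = map ((+) (- real (Suc (length xs)))) (AP (length zs)) @
        map ((+) (real (length zs))) (AP (Suc (length xs)))"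
      unfolding AP_add[symmetric] by (simp add: add.commute)
    \<comment> \<open>Deleting the first entry of one progression and the last entry of the other
      leaves centred progressions shifted by 1 and by -1. The shifts cancel in the sums, so the
      induction hypothesis applies to the remaining grid.\<close>
    have "mset (pairsums (AP (length (x # xs))) (AP (length ys)))
      = mset (pairsums (- real (length xs) # map ((+) 1) (AP (length xs)))
               (map ((+) (- 1)) (AP (length zs)) @ [real (length zs)]))"
      by (simp add: snoc flip: AP_Suc_Cons AP_Suc_snoc)
    also have "\<dots> = mset (AP (length ?h)) + mset (pairsums (AP (length xs)) (AP (length zs)))"
      unfolding mset_pairsums_hook pairsums_shift h
      by (simp add: AP_Suc_Cons o_def algebra_simps) (intro image_mset_cong, simp)
    finally show ?thesis
      using cs Cons.prems mset_pairsums_hook[of x xs zs y] sep_hook[of x xs zs y]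
      by (intro exI[of _ "?h # cs"]) (simp add: snoc)
  qed
qed

text \<open>Up to permutation, sums distribute over concatenation, so each chain can be decomposed
  against \<open>xs\<close> separately.\<close>

lemma pairsums_concat_chains:
  assumes "sep xs" "\<forall>c\<in>set cs. sep c"
  shows "\<exists>ds. mset (pairsums xs (concat cs)) = mset (concat ds) \<and> (\<forall>d\<in>set ds. sep d) \<and>
    mset (pairsums (AP (length xs)) (concat (map (\<lambda>c. AP (length c)) cs)))
      = mset (concat (map (\<lambda>c. AP (length c)) ds))"
  using assms(2)
proof (induction cs)
  case Nil
  then show ?case by (intro exI[of _ "[]"]) simp
next
  case (Cons c cs)
  then obtain ds where ds: "mset (pairsums xs (concat cs)) = mset (concat ds)" "\<forall>d\<in>set ds. sep d"
    "mset (pairsums (AP (length xs)) (concat (map (\<lambda>c. AP (length c)) cs)))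
      = mset (concat (map (\<lambda>c. AP (length c)) ds))" by auto
  obtain es where es: "mset (pairsums xs c) = mset (concat es)" "\<forall>d\<in>set es. sep d"
    "mset (pairsums (AP (length xs)) (AP (length c))) = mset (concat (map (\<lambda>c. AP (length c)) es))"
    using pairsums_chains[OF assms(1), of c] Cons.prems by auto
  show ?case
    using ds es by (intro exI[of _ "es @ ds"]) (auto simp: mset_pairsums_append)
qed

lemma multisums_Nil [simp]: "multisums [] = [0]"
  and multisums_Cons: "multisums (ys # yss) = pairsums ys (multisums yss)"
  by (simp_all add: multisums_def)

lemma multisums_chains:
  assumes "\<forall>ys\<in>set yss. sep ys"
  shows "\<exists>cs. mset (multisums yss) = mset (concat cs) \<and> (\<forall>c\<in>set cs. sep c) \<and>
    mset (multisums (map (\<lambda>c. AP (length c)) yss)) = mset (concat (map (\<lambda>c. AP (length c)) cs))"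
  using assms
proof (induction yss)
  case Nil
  \<comment> \<open>The empty sum forms the single chain \<open>[0]\<close>, which is also
    \<open>AP 1\<close>.\<close>
  then show ?case by (intro exI[of _ "[[0]]"]) (simp add: sep_def AP_def)
next
  case (Cons ys yss)
  then obtain cs where cs: "mset (multisums yss) = mset (concat cs)" "\<forall>c\<in>set cs. sep c"
    "mset (multisums (map (\<lambda>c. AP (length c)) yss)) = mset (concat (map (\<lambda>c. AP (length c)) cs))" by auto
  obtain ds where ds: "mset (pairsums ys (concat cs)) = mset (concat ds)" "\<forall>d\<in>set ds. sep d"
    "mset (pairsums (AP (length ys)) (concat (map (\<lambda>c. AP (length c)) cs)))
      = mset (concat (map (\<lambda>c. AP (length c)) ds))"
    using pairsums_concat_chains[of ys cs] Cons.prems cs by auto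
  show ?case
    using ds mset_pairsums_cong[OF cs(1), of ys] mset_pairsums_cong[OF cs(3), of "AP (length ys)"]
    by (intro exI[of _ ds]) (simp add: multisums_Cons)
qed

section \<open>Counting the points of a chain in a window\<close>

lemma sep_filter: "sep xs \<Longrightarrow> sep (filter P xs)"
  by (simp add: sep_def sorted_wrt_filter)

lemma sep_nth_ge:
  assumes "sep xs" "i < length xs"
  shows "xs ! 0 + 2 * real i \<le> xs ! i"
  using assms(2)
proof (induction i)
  case (Suc i)
  have "xs ! i + 2 \<le> xs ! Suc i"
    using assms(1) Suc.prems by (auto simp: sep_def sorted_wrt_iff_nth_less)
  with Suc show ?case by simp
qed simp

text \<open>Any \<open>l + 1\<close> points with gaps at least 2 span a distance of at least
  \<open>2 * l\<close>, which does not fit into a half-open window of that length.\<close>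

lemma length_filter_sep_le:
  assumes "sep xs"
  shows "length (filter (\<lambda>s. s \<in> {x<..x + 2 * real l}) xs) \<le> min l (length xs)"
proof -
  define zs where "zs = filter (\<lambda>s. s \<in> {x<..x + 2 * real l}) xs"
  have "length zs \<le> l"
  proof (rule ccontr)
    assume "\<not> length zs \<le> l"
    then have "l < length zs" "0 < length zs" by auto
    moreover from this have "zs ! 0 \<in> set zs" "zs ! l \<in> set zs" by (auto intro: nth_mem)
    then have "x < zs ! 0" "zs ! l \<le> x + 2 * real l" by (auto simp: zs_def)
    moreover have "zs ! 0 + 2 * real l \<le> zs ! l"
      using calculation(1) assms by (intro sep_nth_ge) (auto simp: zs_def sep_filter)
    ultimately show False by simp
  qed
  then show ?thesis by (simp add: zs_def)
qed

lemma length_filter_AP: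
  "length (filter (\<lambda>s. s \<in> {- real l<..real l}) (AP k)) = min l k"
proof -
  have "length (filter (\<lambda>s. s \<in> {- real l<..real l}) (AP k))
     = card {i. i < k \<and> AP k ! i \<in> {- real l<..real l}}"
    by (simp add: length_filter_conv_card)
  \<comment> \<open>The lower end is half of \<open>k - l\<close>, rounded up: the first index whose
    term exceeds \<open>-l\<close>. For \<open>l \<ge> k\<close> the truncated subtraction makes it
    0, and every index is hit. The half-open window makes the count independent of parity.\<close>
  also have "{i. i < k \<and> AP k ! i \<in> {- real l<..real l}} = {(k - l + 1) div 2..<(k - l + 1) div 2 + min l k}"
  proof (intro set_eqI iffI)
    show "i \<in> {(k - l + 1) div 2..<(k - l + 1) div 2 + min l k}"
      if "i \<in> {i. i < k \<and> AP k ! i \<in> {- real l<..real l}}" for i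
    proof -
      have "i < k" "- real l < 2 * real i - real k + 1" "2 * real i - real k + 1 \<le> real l"
        using that by (auto simp: nth_AP)
      then have "k < 2 * i + 1 + l" "2 * i + 1 \<le> l + k" "i < k" by linarith+
      then show ?thesis by (cases "k \<le> l") (auto simp: min_def)
    qed
  next
    show "i \<in> {i. i < k \<and> AP k ! i \<in> {- real l<..real l}}"
      if "i \<in> {(k - l + 1) div 2..<(k - l + 1) div 2 + min l k}" for i
    proof -
      have "k < 2 * i + 1 + l" "2 * i + 1 \<le> l + k" "i < k"
        using that by (auto simp: min_def split: if_splits; linarith)+
      then have "real k < 2 * real i + 1 + real l" "2 * real i + 1 \<le> real l + real k" by linarith+
      then show ?thesis using \<open>i < k\<close> by (simp add: nth_AP)
    qed
  qed
  finally show ?thesis by simp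
qed

text \<open>Both counts are sums over the same chains. A chain \<open>c\<close> contributes at most
  \<open>min l (length c)\<close> on the left and exactly that on the right.\<close>

lemma count_multisums_le:
  assumes "\<forall>ys\<in>set yss. sep ys"
  shows "length (filter (\<lambda>s. s \<in> {x<..x + 2 * real l}) (multisums yss))
    \<le> length (filter (\<lambda>s. s \<in> {- real l<..real l}) (multisums (map (\<lambda>c. AP (length c)) yss)))"
proof -
  have size: "length (filter P zs) = sum_list (map (length \<circ> filter P) cs)"
    if "mset zs = mset (concat cs)" for P :: "real \<Rightarrow> bool" and zs cs
  proof -
    have "length (filter P zs) = length (filter P (concat cs))"
      by (metis mset_filter size_mset that)
    then show ?thesis by (simp add: filter_concat length_concat o_def)
  qed
  obtain cs where cs: "mset (multisums yss) = mset (concat cs)" "\<forall>c\<in>set cs. sep c"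
    "mset (multisums (map (\<lambda>c. AP (length c)) yss)) = mset (concat (map (\<lambda>c. AP (length c)) cs))"
    using multisums_chains[OF assms] by blast
  show ?thesis
    unfolding size[OF cs(1)] size[OF cs(3)] map_map
    by (rule sum_list_mono) (use cs(2) in \<open>simp only: o_apply length_filter_AP length_filter_sep_le\<close>)
qed

section \<open>Quantile transform: from laws to separated lists\<close>

lemma T_index_bounds:
  assumes "T_index \<alpha> k"
  shows "1 \<le> k" "0 < \<alpha>" "real k * \<alpha> \<le> 1" "1 \<le> (real k + 1) * \<alpha>"
proof -
  show k: "1 \<le> k" using assms by (simp add: T_index_def)
  have "1 / (real k + 1) \<le> \<alpha>" "\<alpha> \<le> 1 / real k" using assms by (auto simp: T_index_def)
  then show "real k * \<alpha> \<le> 1" "1 \<le> (real k + 1) * \<alpha>" using k by (auto simp: field_simps)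
  then show "0 < \<alpha>" using k by (smt (verit) mult_nonneg_nonpos of_nat_0_le_iff)
qed

text \<open>If \<open>I t - 2 < I s\<close>, then the distribution function is below
  \<open>s\<close> at \<open>I t - 2\<close> and at least \<open>t\<close> at \<open>I t\<close>, so
  the window between them has mass above \<open>t - s \<ge> \<alpha>\<close>.\<close>

lemma (in cdf_distribution) quantile_separated:
  assumes "\<And>x. measure M {x<..x + 2} \<le> \<alpha>" "0 < s" "s + \<alpha> \<le> t" "t < 1" "0 \<le> \<alpha>"
  shows "I s + 2 \<le> I t"
proof (rule ccontr)
  assume "\<not> I s + 2 \<le> I t"
  then have "\<not> I s \<le> I t - 2" by simp
  then have "C (I t - 2) < s"
    using pseudoinverse[of s "I t - 2"] assms by simp
  moreover have "t \<le> C (I t)"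
    using pseudoinverse[of t "I t"] assms by simp
  moreover have "C (I t) - C (I t - 2) = measure M {I t - 2<..I t}"
    by (rule cdf_diff_eq) simp
  ultimately show False
    using assms(1)[of "I t - 2"] assms(3) by simp
qed

lemma (in cdf_distribution) sep_quantiles:
  assumes "\<And>x. measure M {x<..x + 2} \<le> \<alpha>" "0 < u" "0 \<le> \<alpha>" "u + (real m - 1) * \<alpha> < 1"
  shows "sep (map (\<lambda>j. I (real j * \<alpha> + u)) [0..<m])"
  unfolding sep_def sorted_wrt_map unfolding sorted_wrt_iff_nth_less
proof (intro allI impI)
  fix i j assume ij: "i < j" "j < length [0..<m]"
  have "(real i + 1) * \<alpha> \<le> real j * \<alpha>" "real j * \<alpha> \<le> (real m - 1) * \<alpha>"
    using ij assms(3) by (intro mult_right_mono; simp)+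
  moreover have "0 \<le> real i * \<alpha>" using assms(3) by simp
  ultimately show "I (real ([0..<m] ! i) * \<alpha> + u) + 2 \<le> I (real ([0..<m] ! j) * \<alpha> + u)"
    using ij assms by (intro quantile_separated[OF assms(1)]) (auto simp: distrib_right intro: add_nonneg_pos)
qed

text \<open>The mixture over lists in integrated form. The weights are the lengths of the sets of
  \<open>u\<close> in \<open>(0, \<alpha>)\<close> for which \<open>k + 1\<close>, respectively
  \<open>k\<close>, of the points \<open>u + j * \<alpha>\<close> lie in
  \<open>(0, 1)\<close>.\<close>

lemma (in cdf_distribution) nn_integral_le_separated:
  fixes g :: "real \<Rightarrow> ennreal"
  assumes k: "T_index \<alpha> k" and conc: "\<And>x. measure M {x<..x + 2} \<le> \<alpha>"
    and g[measurable]: "g \<in> borel_measurable borel"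
    and b: "\<And>ys. sep ys \<Longrightarrow> length ys = k + 1 \<Longrightarrow> (\<Sum>y\<leftarrow>ys. g y) \<le> b"
    and c: "\<And>ys. sep ys \<Longrightarrow> length ys = k \<Longrightarrow> (\<Sum>y\<leftarrow>ys. g y) \<le> c"
  shows "(\<integral>\<^sup>+x. g x \<partial>M) \<le> ennreal (1 - real k * \<alpha>) * b + ennreal ((real k + 1) * \<alpha> - 1) * c"
proof -
  note kb = T_index_bounds[OF k]
  \<comment> \<open>The cut-off to \<open>(0, 1)\<close>, where the quantile function is meaningful,
    allows the integrand to be translated freely on the real line.\<close>
  define h where "h v = g (I v) * indicator {0<..<1} v" for v :: real
  have h_meas[measurable]: "h \<in> borel_measurable borel"
    unfolding h_def
    by (subst borel_measurable_restrict_space_iff_ennreal[symmetric])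
      (auto intro!: measurable_compose[OF measurable_CI g])
  have "(\<integral>\<^sup>+x. g x \<partial>M) = (\<integral>\<^sup>+x. g x \<partial>distr (restrict_space lborel {0<..<1::real}) borel I)"
    by (simp only: distr_I_eq_M)
  also have "\<dots> = (\<integral>\<^sup>+v. g (I v) \<partial>restrict_space lborel {0<..<1})"
    using measurable_CI
    by (intro nn_integral_distr)
      (simp_all add: g measurable_cong_sets[OF sets_restrict_space_cong[OF sets_lborel] refl])
  also have "\<dots> = (\<integral>\<^sup>+v. h v \<partial>lborel)"
    unfolding h_def by (subst nn_integral_restrict_space) auto
  \<comment> \<open>The \<open>k + 1\<close> cells of length \<open>\<alpha>\<close> cover
    \<open>(0, 1)\<close> because \<open>(k + 1) * \<alpha> \<ge> 1\<close>. Where the last cell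
    overhangs, \<open>h\<close> vanishes.\<close>
  also have "\<dots> \<le> (\<integral>\<^sup>+v. (\<Sum>j\<le>k. h v * indicator {real j * \<alpha><..(real j + 1) * \<alpha>} v) \<partial>lborel)"
  proof (intro nn_integral_mono)
    fix v :: real
    show "h v \<le> (\<Sum>j\<le>k. h v * indicator {real j * \<alpha><..(real j + 1) * \<alpha>} v)"
    proof (cases "0 < v \<and> v < 1")
      case True
      define j where "j = (LEAST j. v \<le> (real j + 1) * \<alpha>)"
      have ex: "v \<le> (real k + 1) * \<alpha>" using True kb by simp
      have j: "v \<le> (real j + 1) * \<alpha>" "j \<le> k"
        unfolding j_def using ex by (rule LeastI, rule Least_le)
      have "real j * \<alpha> < v"
      proof (cases j)
        case (Suc i)
        then have "\<not> v \<le> (real i + 1) * \<alpha>"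
          using not_less_Least[of i "\<lambda>j. v \<le> (real j + 1) * \<alpha>"] by (simp add: j_def)
        then show ?thesis using Suc by (simp add: add.commute)
      qed (use True in simp)
      then have "h v \<le> h v * indicator {real j * \<alpha><..(real j + 1) * \<alpha>} v"
        using j by simp
      also have "\<dots> \<le> (\<Sum>j\<le>k. h v * indicator {real j * \<alpha><..(real j + 1) * \<alpha>} v)"
        using j by (intro member_le_sum) auto
      finally show ?thesis .
    qed (auto simp: h_def)
  qed
  also have "\<dots> = (\<Sum>j\<le>k. \<integral>\<^sup>+v. h v * indicator {real j * \<alpha><..(real j + 1) * \<alpha>} v \<partial>lborel)"
    by (rule nn_integral_sum) simp
  \<comment> \<open>All cells are translated onto \<open>(0, \<alpha>]\<close>, so that one
    \<open>u\<close> governs a whole list of quantiles.\<close>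
  also have "\<dots> = (\<Sum>j\<le>k. \<integral>\<^sup>+u. h (real j * \<alpha> + u) * indicator {0<..\<alpha>} u \<partial>lborel)"
  proof (rule sum.cong[OF refl])
    fix j
    show "(\<integral>\<^sup>+v. h v * indicator {real j * \<alpha><..(real j + 1) * \<alpha>} v \<partial>lborel)
      = (\<integral>\<^sup>+u. h (real j * \<alpha> + u) * indicator {0<..\<alpha>} u \<partial>lborel)"
      by (subst nn_integral_real_affine[where c = 1 and t = "real j * \<alpha>"])
        (auto intro!: nn_integral_cong simp: indicator_def distrib_right)
  qed
  also have "\<dots> = (\<integral>\<^sup>+u. (\<Sum>j\<le>k. h (real j * \<alpha> + u) * indicator {0<..\<alpha>} u) \<partial>lborel)"
    by (rule nn_integral_sum[symmetric]) simp
  also have "\<dots> \<le> (\<integral>\<^sup>+u. b * indicator {0<..<1 - real k * \<alpha>} u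
      + c * indicator {1 - real k * \<alpha>..<\<alpha>} u \<partial>lborel)"
  proof (rule nn_integral_mono_AE)
    \<comment> \<open>At \<open>u = \<alpha>\<close> there may be only \<open>k - 1\<close> points, if \<open>k * \<alpha> = 1\<close>.\<close>
    show "AE u in lborel. (\<Sum>j\<le>k. h (real j * \<alpha> + u) * indicator {0<..\<alpha>} u)
      \<le> b * indicator {0<..<1 - real k * \<alpha>} u + c * indicator {1 - real k * \<alpha>..<\<alpha>} u"
      using AE_lborel_singleton[of \<alpha>]
    proof eventually_elim
      case (elim u)
      have hg: "(\<Sum>j<m. h (real j * \<alpha> + u)) = (\<Sum>y\<leftarrow>map (\<lambda>j. I (real j * \<alpha> + u)) [0..<m]. g y)"
        if "0 < u" "u + (real m - 1) * \<alpha> < 1" for m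
      proof -
        have "(\<Sum>j<m. h (real j * \<alpha> + u)) = (\<Sum>j<m. g (I (real j * \<alpha> + u)))"
        proof (rule sum.cong[OF refl])
          fix j assume "j \<in> {..<m}"
          then have "real j * \<alpha> \<le> (real m - 1) * \<alpha>" "0 \<le> real j * \<alpha>"
            using kb(2) by (auto intro!: mult_right_mono)
          then have "0 < real j * \<alpha> + u" "real j * \<alpha> + u < 1" using that by linarith+
          then show "h (real j * \<alpha> + u) = g (I (real j * \<alpha> + u))" by (simp add: h_def)
        qed
        then show ?thesis
          by (simp add: o_def sum_list_distinct_conv_sum_set atLeast0LessThan)
      qed
      consider "u \<le> 0 \<or> \<alpha> < u" | "0 < u" "u < 1 - real k * \<alpha>" "u < \<alpha>"
        | "0 < u" "u \<ge> 1 - real k * \<alpha>" "u < \<alpha>"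
        using elim by linarith
      then show ?case
      proof cases
        case 1
        then show ?thesis by auto
      next
        case 2
        have "sep (map (\<lambda>j. I (real j * \<alpha> + u)) [0..<k + 1])"
          using 2 kb by (intro sep_quantiles conc) auto
        from b[OF this] show ?thesis
          using 2 hg[of "k + 1"] by (simp flip: lessThan_Suc_atMost)
      next
        case 3
        have u: "u + (real k - 1) * \<alpha> < 1" using 3 kb by (simp add: left_diff_distrib)
        have "sep (map (\<lambda>j. I (real j * \<alpha> + u)) [0..<k])"
          using 3 kb u by (intro sep_quantiles conc) auto
        from c[OF this] have "(\<Sum>j<k. h (real j * \<alpha> + u)) \<le> c"
          using hg[of k] 3 u by simp
        \<comment> \<open>The last argument has reached 1, so the cut-off removes its term and
          \<open>k\<close> points remain.\<close>
        moreover have "h (real k * \<alpha> + u) = 0" using 3 by (simp add: h_def)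
        ultimately show ?thesis
          using 3 by (simp flip: lessThan_Suc_atMost)
      qed
    qed
  qed
  also have "\<dots> = ennreal (1 - real k * \<alpha>) * b + ennreal ((real k + 1) * \<alpha> - 1) * c"
    using kb by (subst nn_integral_add)
      (auto simp: nn_integral_cmult_indicator distrib_right mult.commute algebra_simps)
  finally show ?thesis .
qed

section \<open>Integration against the law of T(\<alpha>)\<close>

lemma nn_integral_nu:
  fixes g :: "real \<Rightarrow> ennreal"
  assumes "0 < k"
  shows "(\<integral>\<^sup>+x. g x \<partial>nu k) = (\<Sum>y\<leftarrow>AP k. g y) / of_nat k"
proof -
  have inj: "inj_on (\<lambda>j. 2 * real j - real k + 1) {..<k}" by (auto intro: inj_onI)
  have "(\<integral>\<^sup>+x. g x \<partial>nu k) = (\<Sum>x\<in>(\<lambda>j. 2 * real j - real k + 1) ` {..<k}. g x) / of_nat k"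
    unfolding nu_def using assms by (subst nn_integral_pmf_of_set) (auto simp: card_image[OF inj])
  also have "\<dots> = (\<Sum>y\<leftarrow>AP k. g y) / of_nat k"
    using inj by (subst sum.reindex) (simp_all add: AP_def o_def sum_list_distinct_conv_sum_set atLeast0LessThan)
  finally show ?thesis .
qed

text \<open>Dividing the mixture weights by the numbers of points yields exactly the weights in
  \<open>nn_integral_le_separated\<close>, so the bound there is matched with equality by
  \<open>T_law \<alpha>\<close>.\<close>

lemma nn_integral_T_law:
  fixes g :: "real \<Rightarrow> ennreal"
  assumes k: "T_index \<alpha> k" and g: "g \<in> borel_measurable borel"
  shows "(\<integral>\<^sup>+x. g x \<partial>T_law \<alpha>) =
    ennreal (1 - real k * \<alpha>) * (\<Sum>y\<leftarrow>AP (k + 1). g y)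
    + ennreal ((real k + 1) * \<alpha> - 1) * (\<Sum>y\<leftarrow>AP k. g y)"
proof -
  note kb = T_index_bounds[OF k]
  define p where "p = real k * (real k + 1) * \<alpha> - real k"
  have p1: "p = real k * ((real k + 1) * \<alpha> - 1)" and p2: "1 - p = (real k + 1) * (1 - real k * \<alpha>)"
    by (simp_all add: p_def algebra_simps)
  have p: "0 \<le> p" "p \<le> 1"
    using kb p1 p2 by (simp, smt (verit) mult_nonneg_nonneg of_nat_0_le_iff)
  have div: "ennreal (a * b) * (x / of_nat m) = ennreal b * x" if "a = real m" "0 < m" "0 \<le> b" for a b x m
  proof -
    have "ennreal (a * b) * (x / of_nat m) = (ennreal b * x) * (of_nat m / of_nat m)"
      using that by (simp add: ennreal_mult ennreal_of_nat_eq_real_of_nat divide_ennreal_def ac_simps)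
    also have "of_nat m / of_nat m = (1::ennreal)"
      using that by (intro ennreal_divide_self) (auto simp: ennreal_of_nat_eq_real_of_nat)
    finally show ?thesis by simp
  qed
  have "(\<integral>\<^sup>+x. g x \<partial>T_law \<alpha>) = (\<integral>\<^sup>+x. g x \<partial>nu_mixture k \<alpha>)"
    unfolding T_law_def T_pmf_eq[OF k] by (rule nn_integral_distr) (simp_all add: g)
  also have "\<dots> = ennreal p * ((\<Sum>y\<leftarrow>AP k. g y) / of_nat k)
      + ennreal (1 - p) * ((\<Sum>y\<leftarrow>AP (k + 1). g y) / of_nat (k + 1))"
    unfolding nu_mixture_def p_def[symmetric]
    using p kb(1) nn_integral_nu[of k g] nn_integral_nu[of "k + 1" g]
    by (simp add: mult.commute)
  also have "ennreal p * ((\<Sum>y\<leftarrow>AP k. g y) / of_nat k)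
    = ennreal ((real k + 1) * \<alpha> - 1) * (\<Sum>y\<leftarrow>AP k. g y)"
    unfolding p1 by (rule div) (use kb in auto)
  also have "ennreal (1 - p) * ((\<Sum>y\<leftarrow>AP (k + 1). g y) / of_nat (k + 1))
    = ennreal (1 - real k * \<alpha>) * (\<Sum>y\<leftarrow>AP (k + 1). g y)"
    unfolding p2 by (rule div) (use kb in auto)
  finally show ?thesis by (simp only: add.commute)
qed

section \<open>Expected numbers of hits and induction on the number of variables\<close>

definition hits :: "'a measure \<Rightarrow> ('a \<Rightarrow> real) \<Rightarrow> real set \<Rightarrow> real list \<Rightarrow> ennreal" where
  "hits M S A L = (\<Sum>s\<leftarrow>L. emeasure M {\<omega> \<in> space M. S \<omega> + s \<in> A})"

lemma hits_pairsums: "hits M S A (pairsums ys L) = (\<Sum>y\<leftarrow>ys. hits M S A (map ((+) y) L))"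
  by (induction ys) (simp_all add: hits_def pairsums_Cons)

lemma (in prob_space) measurable_hits:
  assumes [measurable]: "random_variable borel S" "A \<in> sets borel"
  shows "(\<lambda>x. hits M S A (map ((+) x) L)) \<in> borel_measurable borel"
proof (induction L)
  case (Cons s L)
  have "{p \<in> space (borel \<Otimes>\<^sub>M M). S (snd p) + (fst p + s) \<in> A} \<in> sets (borel \<Otimes>\<^sub>M M)"
    by measurable
  from measurable_emeasure_Pair[OF this]
  have "(\<lambda>x. emeasure M {\<omega> \<in> space M. S \<omega> + (x + s) \<in> A}) \<in> borel_measurable borel"
    by (simp add: vimage_def space_pair_measure)
  with Cons show ?case by (simp add: hits_def)
qed (simp add: hits_def)

text \<open>Fubini for the convolution: fixing the value of \<open>X\<close> adds it to every offset
  in \<open>L\<close>.\<close>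

lemma (in prob_space) hits_add_indep:
  assumes ind: "indep_var borel X borel S" and [measurable]: "A \<in> sets borel"
  shows "hits M (\<lambda>\<omega>. X \<omega> + S \<omega>) A L = (\<integral>\<^sup>+x. hits M S A (map ((+) x) L) \<partial>distr M borel X)"
proof -
  have X[measurable]: "random_variable borel X" and S[measurable]: "random_variable borel S"
    using indep_var_rv1[OF ind] indep_var_rv2[OF ind] .
  have single: "emeasure M {\<omega> \<in> space M. X \<omega> + S \<omega> + s \<in> A}
    = (\<integral>\<^sup>+x. emeasure M {\<omega> \<in> space M. S \<omega> + (x + s) \<in> A} \<partial>distr M borel X)" for s
  proof -
    define B where "B = {y. y + s \<in> A}"
    have "{y \<in> space borel. y + s \<in> A} \<in> sets borel" by measurable
    then have [measurable]: "B \<in> sets borel" by (simp add: B_def)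
    have "emeasure M {\<omega> \<in> space M. X \<omega> + S \<omega> + s \<in> A} = emeasure (distr M borel (\<lambda>\<omega>. X \<omega> + S \<omega>)) B"
      by (subst emeasure_distr) (auto simp: B_def intro!: arg_cong[where f = "emeasure M"])
    also have "\<dots> = (\<integral>\<^sup>+x. emeasure (distr M borel S) {a. a + x \<in> B} \<partial>distr M borel X)"
      unfolding sum_indep_random_variable[OF ind X S]
      by (rule convolution_emeasure) (auto intro: finite_measure_distr)
    also have "\<dots> = (\<integral>\<^sup>+x. emeasure M {\<omega> \<in> space M. S \<omega> + (x + s) \<in> A} \<partial>distr M borel X)"
    proof (rule nn_integral_cong)
      fix x
      have "{a \<in> space borel. a + x \<in> B} \<in> sets borel" by measurable
      then have "{a. a + x \<in> B} \<in> sets borel" by simp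
      then show "emeasure (distr M borel S) {a. a + x \<in> B}
        = emeasure M {\<omega> \<in> space M. S \<omega> + (x + s) \<in> A}"
        by (subst emeasure_distr) (auto simp: B_def add.assoc intro!: arg_cong[where f = "emeasure M"])
    qed
    finally show ?thesis .
  qed
  show ?thesis
  proof (induction L)
    case (Cons s L)
    have "(\<lambda>x. emeasure M {\<omega> \<in> space M. S \<omega> + (x + s) \<in> A}) \<in> borel_measurable borel"
      using measurable_hits[OF S, of A "[s]"] by (simp add: hits_def)
    with Cons single measurable_hits[OF S, of A L] show ?case
      by (simp add: hits_def nn_integral_add)
  qed (simp add: hits_def)
qed

lemma (in prob_space) indep_var_Suc_sum:
  fixes X :: "nat \<Rightarrow> 'a \<Rightarrow> real"
  assumes "indep_vars (\<lambda>_. borel) X {1..Suc n}"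
  shows "indep_var borel (X (Suc n)) borel (\<lambda>\<omega>. \<Sum>i=1..n. X i \<omega>)"
  by (rule indep_vars_sum) (use assms in \<open>auto simp: atLeastAtMostSuc_conv\<close>)

lemma (in prob_space) measure_le_concentration:
  "measure M {\<omega> \<in> space M. X \<omega> \<in> {x<..x + h}} \<le> concentration M h X"
  unfolding concentration_def
  by (rule cSUP_upper) (auto intro!: bdd_aboveI[of _ 1])

text \<open>A strengthening of the theorem that admits induction: \<open>hits\<close> is the
  expected number of offsets \<open>s\<close> that bring the random sum into the window, and the
  offsets are the sums over arbitrary separated lists. Each step trades one random variable for one
  more list; with none left, \<open>count_multisums_le\<close> decides.\<close>

lemma hits_multisums_le:
  fixes X :: "nat \<Rightarrow> 'a \<Rightarrow> real" and T :: "nat \<Rightarrow> 'b \<Rightarrow> real"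
  assumes "prob_space M" "prob_space N"
    and "\<And>i. i \<in> {1..n} \<Longrightarrow> \<alpha> i \<in> {0<..1}"
    and "prob_space.indep_vars M (\<lambda>_. borel) X {1..n}"
    and "\<And>i. i \<in> {1..n} \<Longrightarrow> concentration M 2 (X i) \<le> \<alpha> i"
    and "prob_space.indep_vars N (\<lambda>_. borel) T {1..n}"
    and "\<And>i. i \<in> {1..n} \<Longrightarrow> distr N borel (T i) = T_law (\<alpha> i)"
    and "\<forall>ys\<in>set yss. sep ys"
  shows "hits M (\<lambda>\<omega>. \<Sum>i=1..n. X i \<omega>) {x<..x + 2 * real l} (multisums yss)
    \<le> hits N (\<lambda>\<omega>. \<Sum>i=1..n. T i \<omega>) {- real l<..real l} (multisums (map (\<lambda>ys. AP (length ys)) yss))"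
  using assms(3-)
proof (induction n arbitrary: yss)
  case 0
  interpret M: prob_space M by fact
  interpret N: prob_space N by fact
  have const: "hits K (\<lambda>\<omega>. \<Sum>i=1..0. Y i \<omega>) A L = of_nat (length (filter (\<lambda>s. s \<in> A) L))"
    if "emeasure K (space K) = 1" for K :: "'c measure" and Y :: "nat \<Rightarrow> 'c \<Rightarrow> real" and A L
    using that by (induction L) (auto simp: hits_def)
  show ?case
    unfolding const[OF M.emeasure_space_1] const[OF N.emeasure_space_1]
    using count_multisums_le[OF 0(6)] by (simp add: of_nat_mono)
next
  case (Suc n)
  interpret M: prob_space M by fact
  interpret N: prob_space N by fact
  let ?A = "{x<..x + 2 * real l}" and ?B = "{- real l<..real l}"
  let ?S = "\<lambda>\<omega>. \<Sum>i=1..n. X i \<omega>" and ?U = "\<lambda>\<omega>. \<Sum>i=1..n. T i \<omega>"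
  let ?zss = "map (\<lambda>ys. AP (length ys)) yss"
  note indX = M.indep_var_Suc_sum[OF Suc.prems(2)] and indT = N.indep_var_Suc_sum[OF Suc.prems(4)]
  have rvX: "M.random_variable borel (X (Suc n))" and rvS: "M.random_variable borel ?S"
    using M.indep_var_rv1[OF indX] M.indep_var_rv2[OF indX] .
  have rvU: "N.random_variable borel ?U"
    using N.indep_var_rv2[OF indT] .
  have IH: "hits M ?S ?A (multisums yss) \<le> hits N ?U ?B (multisums (map (\<lambda>ys. AP (length ys)) yss))"
    if "\<forall>ys\<in>set yss. sep ys" for yss
    using that Suc.prems M.indep_vars_subset[OF Suc.prems(2), of "{1..n}"]
      N.indep_vars_subset[OF Suc.prems(4), of "{1..n}"]
    by (intro Suc.IH) auto
  obtain k where k: "T_index (\<alpha> (Suc n)) k"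
    using T_index_ex Suc.prems(1)[of "Suc n"] by auto
  interpret D: cdf_distribution "distr M borel (X (Suc n))"
    unfolding cdf_distribution_def by (rule M.real_distribution_distr[OF rvX])
  have conc: "measure (distr M borel (X (Suc n))) {x<..x + 2} \<le> \<alpha> (Suc n)" for x
  proof -
    have "measure (distr M borel (X (Suc n))) {x<..x + 2}
      = measure M {\<omega> \<in> space M. X (Suc n) \<omega> \<in> {x<..x + 2}}"
      using rvX by (subst measure_distr) (auto intro!: arg_cong[where f = "measure M"])
    also have "\<dots> \<le> \<alpha> (Suc n)"
      using M.measure_le_concentration[of "X (Suc n)" x 2] Suc.prems(3)[of "Suc n"] by simp
    finally show ?thesis .
  qed
  \<comment> \<open>A list of quantiles of \<open>X (Suc n)\<close> joins the deterministic lists,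
    which is why the induction is over arbitrary \<open>yss\<close>.\<close>
  have bound: "(\<Sum>y\<leftarrow>ys. hits M ?S ?A (map ((+) y) (multisums yss)))
      \<le> (\<Sum>y\<leftarrow>AP m. hits N ?U ?B (map ((+) y) (multisums ?zss)))"
    if "sep ys" "length ys = m" for ys m
    using IH[of "ys # yss"] that Suc.prems(6) by (simp add: multisums_Cons hits_pairsums)
  have "hits M (\<lambda>\<omega>. \<Sum>i=1..Suc n. X i \<omega>) ?A (multisums yss)
    = hits M (\<lambda>\<omega>. X (Suc n) \<omega> + ?S \<omega>) ?A (multisums yss)"
    by (simp add: add.commute)
  also have "\<dots> = (\<integral>\<^sup>+y. hits M ?S ?A (map ((+) y) (multisums yss)) \<partial>distr M borel (X (Suc n)))"
    by (rule M.hits_add_indep[OF indX]) simp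
  also have "\<dots> \<le> ennreal (1 - real k * \<alpha> (Suc n))
        * (\<Sum>y\<leftarrow>AP (k + 1). hits N ?U ?B (map ((+) y) (multisums ?zss)))
      + ennreal ((real k + 1) * \<alpha> (Suc n) - 1)
        * (\<Sum>y\<leftarrow>AP k. hits N ?U ?B (map ((+) y) (multisums ?zss)))"
    by (intro D.nn_integral_le_separated[OF k conc] M.measurable_hits[OF rvS] bound) auto
  also have "\<dots> = (\<integral>\<^sup>+y. hits N ?U ?B (map ((+) y) (multisums ?zss)) \<partial>distr N borel (T (Suc n)))"
    using Suc.prems(5)[of "Suc n"] nn_integral_T_law[OF k N.measurable_hits[OF rvU], of ?B] by simp
  also have "\<dots> = hits N (\<lambda>\<omega>. T (Suc n) \<omega> + ?U \<omega>) ?B (multisums ?zss)"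
    by (rule N.hits_add_indep[OF indT, symmetric]) simp
  also have "\<dots> = hits N (\<lambda>\<omega>. \<Sum>i=1..Suc n. T i \<omega>) ?B (multisums ?zss)"
    by (simp add: add.commute)
  finally show ?case .
qed

theorem theorem1p2:
  fixes n l :: nat
    and \<alpha> :: "nat \<Rightarrow> real"
    and M :: "'a measure" and X :: "nat \<Rightarrow> 'a \<Rightarrow> real"
    and N :: "'b measure" and T :: "nat \<Rightarrow> 'b \<Rightarrow> real"
  assumes "1 \<le> n"
    and "\<And>i. i \<in> {1..n} \<Longrightarrow> \<alpha> i \<in> {0<..1}"
    and "prob_space M"
    and "prob_space.indep_vars M (\<lambda>_. borel) X {1..n}"
    and "\<And>i. i \<in> {1..n} \<Longrightarrow> concentration M 2 (X i) \<le> \<alpha> i"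
    and "prob_space N"
    and "prob_space.indep_vars N (\<lambda>_. borel) T {1..n}"
    and "\<And>i. i \<in> {1..n} \<Longrightarrow> distr N borel (T i) = T_law (\<alpha> i)"
    and "1 \<le> l"
  shows "concentration M (2 * real l) (\<lambda>\<omega>. \<Sum>i=1..n. X i \<omega>)
       \<le> concentration N (2 * real l) (\<lambda>\<omega>. \<Sum>i=1..n. T i \<omega>)"
proof -
  interpret M: prob_space M by fact
  interpret N: prob_space N by fact
  let ?S = "\<lambda>\<omega>. \<Sum>i=1..n. X i \<omega>" and ?U = "\<lambda>\<omega>. \<Sum>i=1..n. T i \<omega>"
  have "measure M {\<omega> \<in> space M. ?S \<omega> \<in> {x<..x + 2 * real l}} \<le> concentration N (2 * real l) ?U" for x
  proof -
    \<comment> \<open>Without lists the only offset is 0, and \<open>hits\<close> is a plain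
      probability. The window on the right is the one starting at \<open>- real l\<close>, hence
      bounded by the concentration function.\<close>
    have "hits M ?S {x<..x + 2 * real l} (multisums [])
      \<le> hits N ?U {- real l<..real l} (multisums (map (\<lambda>ys::real list. AP (length ys)) []))"
      using assms by (intro hits_multisums_le) auto
    then have "measure M {\<omega> \<in> space M. ?S \<omega> \<in> {x<..x + 2 * real l}}
      \<le> measure N {\<omega> \<in> space N. ?U \<omega> \<in> {- real l<..- real l + 2 * real l}}"
      by (simp add: hits_def M.emeasure_eq_measure N.emeasure_eq_measure)
    also have "\<dots> \<le> concentration N (2 * real l) ?U"
      by (rule N.measure_le_concentration)
    finally show ?thesis .
  qed
  then show ?thesis
    unfolding concentration_def[of M] by (intro cSUP_least) auto
qed

end
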